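(* Let $I\subset\mathbb{R}$ be an interval, let $I_1,I_2$ be two subintervals of $I$ with $I_1\cup I_2= I$, and let $\Omega=(I_1\times I_1)\cup(I_2\times I_2)$. Let $K_\Omega:\Omega\to\mathbb{R}$ be any partial covariance on $\Omega$. Define $K_\star:I\times I\to\mathbb{R}$ by $$K_\star(s,t)=\begin{cases}K_\Omega(s,t), & (s,t)\in\Omega,\\ \big\langle K_\Omega(s,\cdot),K_\Omega(\cdot,t)\big\rangle_{\mathscr{H}(K_{I_1\cap I_2})}, & (s,t)\notin\Omega,\end{cases}$$ where $K_{I_1\cap I_2}=K_\Omega|_{(I_1\cap I_2)\times(I_1\cap I_2)}$ and the functions $K_\Omega(s,\cdot)$, $K_\Omega(\cdot,t)$ in the inner product are understood to be restricted to $I_1\cap I_2$. Then $K_\star$ is well defined (these restrictions belong to $\mathscr{H}(K_{I_1\cap I_2})$), it is a covariance on $I$, and it is a completion of $K_\Omega$, i.e. $K_\star\in\mathscr{C}(K_\Omega)$. In particular, if $K_\Omega$ admits a unique completion, then this completion equals $K_\star$.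
   Context: A covariance on a set $S$ is a symmetric function $K:S\times S\to\mathbb{R}$ with $\sum_{i,j=1}^n\alpha_i\alpha_jK(t_i,t_j)\ge 0$ for all $n\ge1$, $t_i\in S$, $\alpha_i\in\mathbb{R}$. A symmetric domain is a set $\Omega\subset I\times I$ containing the diagonal $\{(t,t):t\in I\}$ and such that $(s,t)\in\Omega$ iff $(t,s)\in\Omega$. A partial covariance on a symmetric domain $\Omega$ is a function $K_\Omega:\Omega\to\mathbb{R}$ such that for every $J\subset I$ (not necessarily an interval) with $J\times J\subset\Omega$, the restriction $K_J=K_\Omega|_{J\times J}$ is a covariance on $J$. A completion of $K_\Omega$ is a covariance $K$ on $I$ with $K|_\Omega=K_\Omega$; the set of all completions is $\mathscr{C}(K_\Omega)$. For a covariance $K_J$ on a set $J$, $\mathscr{H}(K_J)$ denotes its reproducing kernel Hilbert space, with $\mathscr{H}(K_\emptyset)=\{0\}$. No continuity or boundedness of $K_\Omega$ is assumed. *)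

theory Defs
  imports "HOL-Analysis.Analysis" "HOL-Library.FuncSet"
begin

text \<open>
  A kernel on \<open>S\<close> is a function on pairs of which only the values on \<open>S \<times> S\<close> matter; restricting
  a kernel to a smaller set therefore just means passing the smaller set.
\<close>

definition covariance_on :: "'a set \<Rightarrow> ('a \<times> 'a \<Rightarrow> real) \<Rightarrow> bool" where
  "covariance_on S K \<longleftrightarrow>
     (\<forall>s\<in>S. \<forall>t\<in>S. K (s, t) = K (t, s)) \<and>
     (\<forall>n\<ge>1. \<forall>(t :: nat \<Rightarrow> 'a) (\<alpha> :: nat \<Rightarrow> real). (\<forall>i<n. t i \<in> S) \<longrightarrow>
        (\<Sum>i<n. \<Sum>j<n. \<alpha> i * \<alpha> j * K (t i, t j)) \<ge> 0)"

definition symmetric_domain :: "'a set \<Rightarrow> ('a \<times> 'a) set \<Rightarrow> bool" where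
  "symmetric_domain I \<Omega> \<longleftrightarrow>
     \<Omega> \<subseteq> I \<times> I \<and> (\<forall>t\<in>I. (t, t) \<in> \<Omega>) \<and> (\<forall>s t. (s, t) \<in> \<Omega> \<longleftrightarrow> (t, s) \<in> \<Omega>)"

definition partial_covariance :: "'a set \<Rightarrow> ('a \<times> 'a) set \<Rightarrow> ('a \<times> 'a \<Rightarrow> real) \<Rightarrow> bool" where
  "partial_covariance I \<Omega> K \<longleftrightarrow>
     symmetric_domain I \<Omega> \<and> (\<forall>J\<subseteq>I. J \<times> J \<subseteq> \<Omega> \<longrightarrow> covariance_on J K)"

text \<open>
  Completions are functions on \<open>I \<times> I\<close>, represented as extensional functions, so that two
  completions are equal iff they agree on \<open>I \<times> I\<close>.
\<close>

definition completions ::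
    "'a set \<Rightarrow> ('a \<times> 'a) set \<Rightarrow> ('a \<times> 'a \<Rightarrow> real) \<Rightarrow> ('a \<times> 'a \<Rightarrow> real) set" where
  "completions I \<Omega> K =
     {C \<in> extensional (I \<times> I). covariance_on I C \<and> (\<forall>p\<in>\<Omega>. C p = K p)}"

text \<open>
  In a function space over \<open>S\<close>, functions \<open>S \<rightarrow> \<real>\<close> are represented by total functions vanishing
  outside \<open>S\<close>.  (Extensional functions would not be closed under pointwise operations.)
\<close>

definition restr0 :: "'a set \<Rightarrow> ('a \<Rightarrow> real) \<Rightarrow> 'a \<Rightarrow> real" where
  "restr0 S f = (\<lambda>u. if u \<in> S then f u else 0)"

definition hilbert_function_space ::
    "'a set \<Rightarrow> ('a \<Rightarrow> real) set \<Rightarrow> (('a \<Rightarrow> real) \<Rightarrow> ('a \<Rightarrow> real) \<Rightarrow> real) \<Rightarrow> bool" where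
  "hilbert_function_space S H ip \<longleftrightarrow>
     (\<forall>f\<in>H. \<forall>x. x \<notin> S \<longrightarrow> f x = 0) \<and>
     (\<lambda>_. 0) \<in> H \<and>
     (\<forall>f\<in>H. \<forall>g\<in>H. (\<lambda>x. f x + g x) \<in> H) \<and>
     (\<forall>c. \<forall>f\<in>H. (\<lambda>x. c * f x) \<in> H) \<and>
     (\<forall>f\<in>H. \<forall>g\<in>H. ip f g = ip g f) \<and>
     (\<forall>f\<in>H. \<forall>g\<in>H. \<forall>h\<in>H. ip (\<lambda>x. f x + g x) h = ip f h + ip g h) \<and>
     (\<forall>c. \<forall>f\<in>H. \<forall>g\<in>H. ip (\<lambda>x. c * f x) g = c * ip f g) \<and>
     (\<forall>f\<in>H. ip f f \<ge> 0 \<and> (ip f f = 0 \<longrightarrow> f = (\<lambda>_. 0))) \<and>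
     (let d = (\<lambda>f g. sqrt (ip (\<lambda>x. f x - g x) (\<lambda>x. f x - g x))) in
       \<forall>F :: nat \<Rightarrow> 'a \<Rightarrow> real.
         range F \<subseteq> H \<and> (\<forall>e>0. \<exists>N. \<forall>m\<ge>N. \<forall>n\<ge>N. d (F m) (F n) < e) \<longrightarrow>
         (\<exists>f\<in>H. (\<lambda>n. d (F n) f) \<longlonglongrightarrow> 0))"

definition is_rkhs ::
    "'a set \<Rightarrow> ('a \<times> 'a \<Rightarrow> real) \<Rightarrow>
     ('a \<Rightarrow> real) set \<Rightarrow> (('a \<Rightarrow> real) \<Rightarrow> ('a \<Rightarrow> real) \<Rightarrow> real) \<Rightarrow> bool" where
  "is_rkhs S K H ip \<longleftrightarrow>
     hilbert_function_space S H ip \<and>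
     (\<forall>t\<in>S. restr0 S (\<lambda>u. K (t, u)) \<in> H \<and>
             (\<forall>f\<in>H. ip f (restr0 S (\<lambda>u. K (t, u))) = f t))"

text \<open>
  For a covariance \<open>K\<close> on \<open>S\<close> the space and, on it, the inner product are uniquely determined
  (Moore--Aronszajn); the values of \<open>ip\<close> outside \<open>H\<close> are irrelevant.
\<close>

definition rkhs :: "'a set \<Rightarrow> ('a \<times> 'a \<Rightarrow> real) \<Rightarrow> ('a \<Rightarrow> real) set" where
  "rkhs S K = (THE H. \<exists>ip. is_rkhs S K H ip)"

definition rkhs_inner ::
    "'a set \<Rightarrow> ('a \<times> 'a \<Rightarrow> real) \<Rightarrow> ('a \<Rightarrow> real) \<Rightarrow> ('a \<Rightarrow> real) \<Rightarrow> real" where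
  "rkhs_inner S K f g = (THE r. \<exists>H ip. is_rkhs S K H ip \<and> f \<in> H \<and> g \<in> H \<and> r = ip f g)"

lemma rkhs_empty: "rkhs {} K = {\<lambda>_. 0}"
  unfolding rkhs_def
proof (rule the_equality)
  show "\<exists>ip. is_rkhs {} K {\<lambda>_. 0} ip"
    by (rule exI[of _ "\<lambda>_ _. 0"])
       (auto simp: is_rkhs_def hilbert_function_space_def Let_def)
next
  fix H assume "\<exists>ip. is_rkhs {} K H ip"
  then have "(\<lambda>_. 0) \<in> H" "\<forall>f\<in>H. \<forall>x. f x = 0"
    by (auto simp: is_rkhs_def hilbert_function_space_def)
  then show "H = {\<lambda>_. 0}" by auto
qed

definition K_star ::
    "'a set \<Rightarrow> 'a set \<Rightarrow> ('a \<times> 'a \<Rightarrow> real) \<Rightarrow> 'a \<times> 'a \<Rightarrow> real" where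
  "K_star I1 I2 K =
     restrict
       (\<lambda>(s, t). if (s, t) \<in> I1 \<times> I1 \<union> I2 \<times> I2 then K (s, t)
         else rkhs_inner (I1 \<inter> I2) K
                (restr0 (I1 \<inter> I2) (\<lambda>u. K (s, u))) (restr0 (I1 \<inter> I2) (\<lambda>u. K (u, t))))
       ((I1 \<union> I2) \<times> (I1 \<union> I2))"

end

theory Submission
  imports Defs
begin

text \<open>
  Write \<open>S = I1 \<inter> I2\<close>. A finite weighted family of points \<open>x = \<Sum> a\<^sub>i \<delta>\<^bsub>t\<^sub>i\<^esub>\<close> carries the
  semi-inner product \<open>gram K x y\<close>, and a function \<open>f\<close> acts on it linearly by \<open>wsum x f\<close>.
  The argument has two halves.

  The reproducing kernel Hilbert space of \<open>K\<close> on \<open>S\<close> consists of the functions \<open>f\<close> whose action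
  is bounded, \<open>(wsum x f)\<^sup>2 \<le> C * gram K x x\<close> for all families \<open>x\<close> over \<open>S\<close>. This concrete
  description avoids quotients and abstract completions. Minimising
  \<open>gram K x x - 2 * wsum x f\<close> gives, as in the proof of the Riesz representation theorem, a sequence
  \<open>x n\<close> of families with \<open>gram K (x n) y \<longlonglongrightarrow> wsum y f\<close>, uniformly on the unit ball
  (\<open>represents_exists\<close>). The limit of \<open>wsum (x n) g\<close> is then the inner product of \<open>f\<close> and \<open>g\<close>: it is
  linear in \<open>g\<close> by construction, and it is symmetric because the representing sequences of \<open>f\<close> and
  of \<open>g\<close> may be paired with each other by \<open>gram\<close> (\<open>represents_sym\<close>). Completeness follows since
  Cauchy sequences converge pointwise and the bounds survive the limit (\<open>is_rkhs_dominated\<close>).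
  In any other reproducing kernel Hilbert space the combinations of kernel sections along
  \<open>x n\<close> form a Cauchy sequence, whose limit can only be \<open>f\<close>; this forces both the space and the inner
  product (\<open>is_rkhs_unique\<close>).

  For \<open>s\<close> in \<open>I1\<close> or in \<open>I2\<close>, Cauchy--Schwarz for the covariance on that set, which contains \<open>S\<close>,
  bounds the action of \<open>K (s, \<cdot>)\<close> on families over \<open>S\<close>; hence \<open>K_star\<close> is well defined.
  To see that it is positive semidefinite, split a family into a part \<open>a\<close> over \<open>I1 - I2\<close> and
  a part \<open>b\<close> over \<open>I2\<close>, and let \<open>g\<close> and \<open>h\<close> be the corresponding combinations of kernel sections
  on \<open>S\<close>. By the reproducing property the cross term between \<open>a\<close> and \<open>b\<close> is the inner product
  of \<open>g\<close> and \<open>h\<close>, also where \<open>b\<close> meets \<open>S\<close>. So the quadratic form is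
  \<open>(gram K a a - \<langle>g, g\<rangle>) + (\<langle>g, g\<rangle> + 2 * \<langle>g, h\<rangle> + gram K b b)\<close>.
  If \<open>z n\<close> represents \<open>g\<close>, the first bracket is the limit of the squared lengths of \<open>a - z n\<close>, computed
  in \<open>I1\<close>, and the second is the limit of the squared lengths of \<open>z n + b\<close>, computed in \<open>I2\<close>
  (\<open>gram_K_star_nonneg\<close>). Probabilistically, \<open>K_star\<close> makes the two sides conditionally uncorrelated
  given the overlap: \<open>a\<close> is replaced by its projection onto \<open>S\<close>, and the residual contributes only
  its own variance.
\<close>

section \<open>Finite weighted families of points\<close>

text \<open>
  A list of weighted points stands for a finitely supported signed measure. Points may repeat,
  so addition is concatenation and no normal form is needed; every notion below is linear in the
  list and does not see the difference.
\<close>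

definition wsum :: "(real \<times> 'a) list \<Rightarrow> ('a \<Rightarrow> real) \<Rightarrow> real" where
  "wsum x f = (\<Sum>(a, t)\<leftarrow>x. a * f t)"

definition wscale :: "real \<Rightarrow> (real \<times> 'a) list \<Rightarrow> (real \<times> 'a) list" where
  "wscale c x = map (\<lambda>(a, t). (c * a, t)) x"

definition weighted_points :: "'a set \<Rightarrow> (real \<times> 'a) list set" where
  "weighted_points S = {x. snd ` set x \<subseteq> S}"

definition gram :: "('a \<times> 'a \<Rightarrow> real) \<Rightarrow> (real \<times> 'a) list \<Rightarrow> (real \<times> 'a) list \<Rightarrow> real" where
  "gram K x y = wsum x (\<lambda>s. wsum y (\<lambda>t. K (s, t)))"

lemma wsum_Nil [simp]: "wsum [] f = 0"
  and wsum_Cons [simp]: "wsum ((a, t) # x) f = a * f t + wsum x f"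
  and wsum_append [simp]: "wsum (x @ y) f = wsum x f + wsum y f"
  by (simp_all add: wsum_def)

lemma wsum_wscale [simp]: "wsum (wscale c x) f = c * wsum x f"
  by (induction x) (auto simp: wscale_def algebra_simps)

lemma wsum_add: "wsum x (\<lambda>t. f t + g t) = wsum x f + wsum x g"
  by (induction x) (auto simp: algebra_simps)

lemma wsum_diff: "wsum x (\<lambda>t. f t - g t) = wsum x f - wsum x g"
  by (induction x) (auto simp: algebra_simps)

lemma wsum_cmult: "wsum x (\<lambda>t. c * f t) = c * wsum x f"
  by (induction x) (auto simp: algebra_simps)

lemma wsum_zero [simp]: "wsum x (\<lambda>t. 0) = 0"
  by (induction x) auto

lemma wsum_swap: "wsum x (\<lambda>s. wsum y (\<lambda>t. F s t)) = wsum y (\<lambda>t. wsum x (\<lambda>s. F s t))"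
  by (induction x) (auto simp: wsum_add wsum_cmult)

lemma wsum_cong:
  assumes "x \<in> weighted_points S" "\<And>t. t \<in> S \<Longrightarrow> f t = g t"
  shows "wsum x f = wsum x g"
  using assms(1) by (induction x) (auto simp: weighted_points_def assms(2))

lemma wsum_tendsto:
  assumes "x \<in> weighted_points S" "\<And>t. t \<in> S \<Longrightarrow> (\<lambda>n. f n t) \<longlonglongrightarrow> g t"
  shows "(\<lambda>n. wsum x (f n)) \<longlonglongrightarrow> wsum x g"
  using assms(1) by (induction x) (auto simp: weighted_points_def intro!: tendsto_intros assms(2))

lemma wsum_filter: "wsum x f = wsum (filter P x) f + wsum (filter (\<lambda>p. \<not> P p) x) f"
  by (induction x) auto

lemma wsum_map_upt: "wsum (map (\<lambda>i. (\<alpha> i, t i)) [0..<n]) f = (\<Sum>i<n. \<alpha> i * f (t i))"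
  by (induction n) auto

lemma weighted_points_intros [simp, intro]:
  "[] \<in> weighted_points S"
  "t \<in> S \<Longrightarrow> [(a, t)] \<in> weighted_points S"
  "x \<in> weighted_points S \<Longrightarrow> y \<in> weighted_points S \<Longrightarrow> x @ y \<in> weighted_points S"
  "x \<in> weighted_points S \<Longrightarrow> wscale c x \<in> weighted_points S"
  by (auto simp: weighted_points_def wscale_def)

lemma weighted_points_mono: "x \<in> weighted_points S \<Longrightarrow> S \<subseteq> T \<Longrightarrow> x \<in> weighted_points T"
  by (auto simp: weighted_points_def)

lemma weighted_points_Cons:
  "(a, t) # x \<in> weighted_points S \<longleftrightarrow> t \<in> S \<and> x \<in> weighted_points S"
  by (auto simp: weighted_points_def)

lemma gram_bilinear [simp]:
  "gram K (x @ y) z = gram K x z + gram K y z"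
  "gram K z (x @ y) = gram K z x + gram K z y"
  "gram K (wscale c x) y = c * gram K x y"
  "gram K x (wscale c y) = c * gram K x y"
  by (simp_all add: gram_def wsum_add wsum_cmult)

lemma gram_sym:
  assumes "covariance_on S K" "x \<in> weighted_points S" "y \<in> weighted_points S"
  shows "gram K x y = gram K y x"
proof -
  have "gram K x y = wsum x (\<lambda>s. wsum y (\<lambda>t. K (t, s)))"
    using assms unfolding gram_def covariance_on_def by (intro wsum_cong) auto
  then show ?thesis
    by (simp add: gram_def wsum_swap[of x])
qed

lemma gram_map_upt:
  "gram K (map (\<lambda>i. (\<alpha> i, t i)) [0..<n]) (map (\<lambda>i. (\<alpha> i, t i)) [0..<n])
     = (\<Sum>i<n. \<Sum>j<n. \<alpha> i * \<alpha> j * K (t i, t j))"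
  by (simp add: gram_def wsum_map_upt sum_distrib_left mult.assoc)

lemma covariance_on_iff_gram:
  "covariance_on S K \<longleftrightarrow>
     (\<forall>s\<in>S. \<forall>t\<in>S. K (s, t) = K (t, s)) \<and> (\<forall>x\<in>weighted_points S. 0 \<le> gram K x x)"
proof (intro iffI conjI ballI)
  fix x assume K: "covariance_on S K" and x: "x \<in> weighted_points S"
  let ?a = "\<lambda>i. fst (x ! i)" and ?t = "\<lambda>i. snd (x ! i)"
  have "x = map (\<lambda>i. (?a i, ?t i)) [0..<length x]"
    by (simp add: map_nth)
  then have "gram K x x
      = (\<Sum>i<length x. \<Sum>j<length x. ?a i * ?a j * K (?t i, ?t j))"
    using gram_map_upt[of K ?a ?t "length x"] by simp
  moreover have "\<forall>i<length x. ?t i \<in> S"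
    using x by (auto simp: weighted_points_def)
  ultimately show "0 \<le> gram K x x"
    using K by (cases "length x \<ge> 1") (auto simp: covariance_on_def gram_def)
next
  assume R: "(\<forall>s\<in>S. \<forall>t\<in>S. K (s, t) = K (t, s)) \<and> (\<forall>x\<in>weighted_points S. 0 \<le> gram K x x)"
  have "0 \<le> (\<Sum>i<n. \<Sum>j<n. \<alpha> i * \<alpha> j * K (t i, t j))"
    if "\<forall>i<n. t i \<in> S" for n and t :: "nat \<Rightarrow> 'a" and \<alpha>
  proof -
    have "map (\<lambda>i. (\<alpha> i, t i)) [0..<n] \<in> weighted_points S"
      using that by (auto simp: weighted_points_def)
    then show ?thesis
      using R unfolding gram_map_upt[symmetric] by blast
  qed
  then show "covariance_on S K"
    using R by (auto simp: covariance_on_def)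
qed (auto simp: covariance_on_def)

lemma covariance_on_subset: "covariance_on T K \<Longrightarrow> S \<subseteq> T \<Longrightarrow> covariance_on S K"
  unfolding covariance_on_iff_gram using weighted_points_mono by blast

text \<open>
  The common source of all Cauchy--Schwarz type bounds below. It allows \<open>e = 0\<close>, as it must for forms
  that are only semidefinite; then \<open>b\<close> has to vanish.
\<close>

lemma nonneg_quadratic_discriminant:
  fixes a b e :: real
  assumes "\<And>c. 0 \<le> a + 2 * c * b + c\<^sup>2 * e" "0 \<le> e"
  shows "b\<^sup>2 \<le> a * e"
proof (cases "e = 0")
  case True
  have "b = 0"
  proof (rule ccontr)
    assume "b \<noteq> 0"
    \<comment> \<open>The form is affine in \<open>c\<close>; this \<open>c\<close> gives it the value \<open>-1\<close>.\<close>
    then show False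
      using assms(1)[of "- (a + 1) / (2 * b)"] True by (simp add: field_simps)
  qed
  then show ?thesis using True by simp
next
  case False
  then have "e > 0" using assms(2) by simp
  then show ?thesis
    using assms(1)[of "- b / e"] by (simp add: field_simps power2_eq_square)
qed

lemma gram_Cauchy_Schwarz:
  assumes K: "covariance_on S K" and x: "x \<in> weighted_points S" and y: "y \<in> weighted_points S"
  shows "(gram K x y)\<^sup>2 \<le> gram K x x * gram K y y"
proof (rule nonneg_quadratic_discriminant)
  fix c
  have "0 \<le> gram K (x @ wscale c y) (x @ wscale c y)"
    using K x y unfolding covariance_on_iff_gram by blast
  then show "0 \<le> gram K x x + 2 * c * gram K x y + c\<^sup>2 * gram K y y"
    using gram_sym[OF K x y] by (simp add: algebra_simps power2_eq_square)
next
  show "0 \<le> gram K y y" using K y by (auto simp: covariance_on_iff_gram)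
qed

text \<open>
  Bounds on a squared length often come out as a multiple of the length itself, which can then be
  cancelled.
\<close>

lemma le_of_square_le_mult:
  fixes u c :: real
  assumes "u\<^sup>2 \<le> c * u" "0 \<le> c"
  shows "u \<le> c"
proof (cases "u > 0")
  case True then show ?thesis using assms by (simp add: power2_eq_square)
qed (use assms(2) in simp)

lemma square_add_le: "(a + b)\<^sup>2 \<le> 2 * a\<^sup>2 + 2 * (b::real)\<^sup>2"
  using sum_squares_bound[of a b] by (simp add: power2_sum)

lemma square_diff_le: "(a - b)\<^sup>2 \<le> 2 * a\<^sup>2 + 2 * (b::real)\<^sup>2"
  using square_add_le[of a "-b"] by simp

lemma tendsto_zero_of_square_le:
  fixes r :: "nat \<Rightarrow> real"
  assumes "\<And>n. (r n)\<^sup>2 \<le> inverse (real (Suc n)) * M"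
  shows "r \<longlonglongrightarrow> 0"
proof -
  have "(\<lambda>n. inverse (real (Suc n)) * M) \<longlonglongrightarrow> 0 * M"
    by (intro tendsto_mult LIMSEQ_inverse_real_of_nat tendsto_const)
  then have "(\<lambda>n. (r n)\<^sup>2) \<longlonglongrightarrow> 0"
    using Lim_null_comparison[of "\<lambda>n. (r n)\<^sup>2" "\<lambda>n. inverse (real (Suc n)) * M"] assms
    by simp
  then show ?thesis
    using tendsto_real_sqrt[of "\<lambda>n. (r n)\<^sup>2" 0 sequentially]
    by (simp add: tendsto_rabs_zero_iff)
qed

section \<open>Functions dominated by a covariance\<close>

locale covariance_kernel =
  fixes S :: "'a set" and K :: "'a \<times> 'a \<Rightarrow> real"
  assumes cov: "covariance_on S K"
begin

abbreviation "V \<equiv> weighted_points S"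

text \<open>
  \<open>dominated_by C f\<close> says that the functional \<open>x \<mapsto> wsum x f\<close> has squared norm at most \<open>C\<close> with respect
  to the semi-inner product \<open>gram K\<close>.
\<close>

definition dominated_by :: "real \<Rightarrow> ('a \<Rightarrow> real) \<Rightarrow> bool" where
  "dominated_by C f \<longleftrightarrow> 0 \<le> C \<and> (\<forall>x\<in>V. (wsum x f)\<^sup>2 \<le> C * gram K x x)"

definition dominated :: "('a \<Rightarrow> real) set" where
  "dominated = {f. (\<forall>t. t \<notin> S \<longrightarrow> f t = 0) \<and> (\<exists>C. dominated_by C f)}"

text \<open>
  The sequence \<open>x\<close> plays the part of the Riesz vector of \<open>f\<close>, which need not exist because finite
  families are not complete. The rate \<open>1 / (n + 1)\<close> is an arbitrary null sequence; fixing it makes the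
  uniformity in \<open>y\<close> a plain inequality.
\<close>

definition represents :: "(nat \<Rightarrow> (real \<times> 'a) list) \<Rightarrow> ('a \<Rightarrow> real) \<Rightarrow> bool" where
  "represents x f \<longleftrightarrow>
     (\<forall>n. x n \<in> V) \<and>
     (\<forall>n. \<forall>y\<in>V. (gram K (x n) y - wsum y f)\<^sup>2 \<le> inverse (real (Suc n)) * gram K y y)"

lemma gram_nonneg: "x \<in> V \<Longrightarrow> 0 \<le> gram K x x"
  using cov by (simp add: covariance_on_iff_gram)

lemma dominated_add:
  assumes "f \<in> dominated" "g \<in> dominated"
  shows "(\<lambda>t. f t + g t) \<in> dominated"
proof -
  obtain C D where C: "dominated_by C f" and D: "dominated_by D g"
    using assms by (auto simp: dominated_def)
  have "dominated_by (2 * C + 2 * D) (\<lambda>t. f t + g t)"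
    unfolding dominated_by_def
  proof (intro conjI ballI)
    fix x assume "x \<in> V"
    then show "(wsum x (\<lambda>t. f t + g t))\<^sup>2 \<le> (2 * C + 2 * D) * gram K x x"
      using C D square_add_le[of "wsum x f" "wsum x g"]
      by (fastforce simp: dominated_by_def wsum_add algebra_simps)
  qed (use C D in \<open>auto simp: dominated_by_def\<close>)
  then show ?thesis using assms by (auto simp: dominated_def)
qed

lemma dominated_cmult:
  assumes "f \<in> dominated"
  shows "(\<lambda>t. c * f t) \<in> dominated"
proof -
  obtain C where C: "dominated_by C f"
    using assms by (auto simp: dominated_def)
  have "dominated_by (c\<^sup>2 * C) (\<lambda>t. c * f t)"
    using C by (auto simp: dominated_by_def wsum_cmult power_mult_distrib mult.assoc
        intro!: mult_left_mono)
  then show ?thesis using assms by (auto simp: dominated_def)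
qed

lemma dominated_zero: "(\<lambda>_. 0) \<in> dominated"
proof -
  have "dominated_by 0 (\<lambda>_. 0)" by (simp add: dominated_by_def)
  then show ?thesis by (auto simp: dominated_def)
qed

lemma dominated_diff:
  assumes "f \<in> dominated" "g \<in> dominated"
  shows "(\<lambda>t. f t - g t) \<in> dominated"
  using dominated_add[OF assms(1) dominated_cmult[OF assms(2), of "-1"]] by simp

lemma dominated_wsum:
  assumes "x \<in> weighted_points T" "\<And>t. t \<in> T \<Longrightarrow> G t \<in> dominated"
  shows "(\<lambda>u. wsum x (\<lambda>t. G t u)) \<in> dominated"
  using assms(1)
proof (induction x)
  case Nil then show ?case by (simp add: dominated_zero)
next
  case (Cons p x)
  then show ?case
    by (cases p) (auto simp: weighted_points_Cons intro!: dominated_add dominated_cmult assms(2))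
qed

text \<open>
  The Riesz representation theorem, in approximate form: let \<open>x n\<close> almost minimise
  \<open>J x = gram K x x - 2 * wsum x f\<close>. Moving from \<open>x n\<close> in direction \<open>c * y\<close> cannot lower \<open>J\<close> by more than
  the remaining gap \<open>1 / (n + 1)\<close>, so the linear term in \<open>c\<close>, which is the error in representing \<open>f\<close>
  at \<open>y\<close>, is controlled by the discriminant.
\<close>

lemma represents_exists:
  assumes "f \<in> dominated"
  shows "\<exists>x. represents x f"
proof -
  obtain C where C: "0 \<le> C" "\<And>x. x \<in> V \<Longrightarrow> (wsum x f)\<^sup>2 \<le> C * gram K x x"
    using assms by (auto simp: dominated_def dominated_by_def)
  define J where "J x = gram K x x - 2 * wsum x f" for x
  have J_ge: "J x \<ge> - C" if "x \<in> V" for x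
  proof -
    have "(wsum x f)\<^sup>2 \<le> ((C + gram K x x) / 2)\<^sup>2"
      using C(2)[OF that] sum_squares_bound[of "C" "gram K x x"]
      by (simp add: power2_eq_square field_simps)
    then have "wsum x f \<le> (C + gram K x x) / 2"
      using C(1) gram_nonneg[OF that] power2_le_imp_le[of "wsum x f" "(C + gram K x x) / 2"] by simp
    then show ?thesis by (simp add: J_def)
  qed
  define m where "m = Inf (J ` V)"
  have bdd: "bdd_below (J ` V)"
    by (rule bdd_belowI2[of _ "- C"]) (rule J_ge)
  have m_le: "m \<le> J x" if "x \<in> V" for x
    unfolding m_def using bdd that by (intro cInf_lower) auto
  have "\<exists>x\<in>V. J x < m + inverse (real (Suc n))" for n
    using cInf_lessD[of "J ` V" "m + inverse (real (Suc n))"] unfolding m_def by force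
  then obtain x where x: "\<And>n. x n \<in> V" "\<And>n. J (x n) < m + inverse (real (Suc n))"
    by metis
  have "(gram K (x n) y - wsum y f)\<^sup>2 \<le> inverse (real (Suc n)) * gram K y y" if y: "y \<in> V" for n y
  proof (rule nonneg_quadratic_discriminant)
    fix c
    have "m \<le> J (x n @ wscale c y)" using x(1) y by (intro m_le) auto
    also have "\<dots> = J (x n) + 2 * c * (gram K (x n) y - wsum y f) + c\<^sup>2 * gram K y y"
      using gram_sym[OF cov x(1) y, of n]
      by (simp add: J_def algebra_simps power2_eq_square)
    finally show "0 \<le> inverse (real (Suc n)) + 2 * c * (gram K (x n) y - wsum y f)
        + c\<^sup>2 * gram K y y"
      using x(2)[of n] by linarith
  qed (rule gram_nonneg[OF y])
  then show ?thesis using x(1) unfolding represents_def by blast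
qed

lemma represents_in: "represents x f \<Longrightarrow> x n \<in> V"
  by (simp add: represents_def)

text \<open>
  Test the representation property of both members on their difference \<open>y\<close>: the two errors differ by
  exactly \<open>gram K y y\<close>, and one factor cancels.
\<close>

lemma represents_Cauchy:
  assumes "represents x f"
  shows "gram K (x m @ wscale (-1) (x n)) (x m @ wscale (-1) (x n))
           \<le> 2 * inverse (real (Suc m)) + 2 * inverse (real (Suc n))"
proof (rule le_of_square_le_mult)
  define y where "y = x m @ wscale (-1) (x n)"
  have y: "y \<in> V" unfolding y_def using represents_in[OF assms] by blast
  have "gram K y y = (gram K (x m) y - wsum y f) - (gram K (x n) y - wsum y f)"
    by (subst (1) y_def) simp
  then have "(gram K y y)\<^sup>2
      \<le> 2 * (gram K (x m) y - wsum y f)\<^sup>2 + 2 * (gram K (x n) y - wsum y f)\<^sup>2"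
    using square_diff_le[of "gram K (x m) y - wsum y f" "gram K (x n) y - wsum y f"] by simp
  also have "\<dots> \<le> 2 * (inverse (real (Suc m)) * gram K y y) + 2 * (inverse (real (Suc n)) * gram K y y)"
    using assms y unfolding represents_def by (intro add_mono mult_left_mono) auto
  finally show "(gram K (x m @ wscale (-1) (x n)) (x m @ wscale (-1) (x n)))\<^sup>2
      \<le> (2 * inverse (real (Suc m)) + 2 * inverse (real (Suc n)))
        * gram K (x m @ wscale (-1) (x n)) (x m @ wscale (-1) (x n))"
    unfolding y_def[symmetric] by (simp add: algebra_simps)
qed simp

text \<open>
  Test the representation property of \<open>x n\<close> on \<open>x n\<close> itself: its squared length differs from
  \<open>wsum (x n) f\<close> by at most its length, and \<open>wsum (x n) f\<close> is bounded by a multiple of its length.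
\<close>

lemma represents_bounded:
  assumes x: "represents x f" and f: "f \<in> dominated"
  obtains M where "0 \<le> M" "\<And>n. gram K (x n) (x n) \<le> M"
proof -
  obtain C where C: "0 \<le> C" "\<And>x. x \<in> V \<Longrightarrow> (wsum x f)\<^sup>2 \<le> C * gram K x x"
    using f by (auto simp: dominated_def dominated_by_def)
  have "gram K (x n) (x n) \<le> 2 + 2 * C" for n
  proof (rule le_of_square_le_mult)
    let ?g = "gram K (x n) (x n)" and ?w = "wsum (x n) f"
    have "(?g - ?w)\<^sup>2 \<le> inverse (real (Suc n)) * ?g"
      using x by (simp add: represents_def)
    also have "\<dots> \<le> 1 * ?g"
      using gram_nonneg[OF represents_in[OF x]]
      by (intro mult_right_mono) (auto simp: field_simps)
    finally have "(?g - ?w)\<^sup>2 \<le> ?g" by simp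
    moreover have "?w\<^sup>2 \<le> C * ?g" using C(2) represents_in[OF x] by blast
    moreover have "?g\<^sup>2 \<le> 2 * (?g - ?w)\<^sup>2 + 2 * ?w\<^sup>2"
      using square_add_le[of "?g - ?w" ?w] by simp
    ultimately show "?g\<^sup>2 \<le> (2 + 2 * C) * ?g" by (simp add: algebra_simps)
  qed (use C(1) in simp)
  then show thesis using C(1) that[of "2 + 2 * C"] by simp
qed

lemma represents_gram_tendsto:
  assumes x: "represents x f" and y: "represents y g" and g: "g \<in> dominated"
  shows "(\<lambda>n. gram K (x n) (y n) - wsum (y n) f) \<longlonglongrightarrow> 0"
proof -
  obtain M where M: "\<And>n. gram K (y n) (y n) \<le> M"
    using represents_bounded[OF y g] by blast
  show ?thesis
  proof (rule tendsto_zero_of_square_le)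
    fix n
    have "(gram K (x n) (y n) - wsum (y n) f)\<^sup>2 \<le> inverse (real (Suc n)) * gram K (y n) (y n)"
      using x represents_in[OF y] by (simp add: represents_def)
    also have "\<dots> \<le> inverse (real (Suc n)) * M"
      by (intro mult_left_mono M) simp
    finally show "(gram K (x n) (y n) - wsum (y n) f)\<^sup>2 \<le> inverse (real (Suc n)) * M" .
  qed
qed

text \<open>
  Both terms are asymptotically \<open>gram K (x n) (y n)\<close>. This yields the symmetry of the inner product
  and its independence of the representing sequence.
\<close>

lemma represents_sym:
  assumes x: "represents x f" and f: "f \<in> dominated"
    and y: "represents y g" and g: "g \<in> dominated"
  shows "(\<lambda>n. wsum (x n) g - wsum (y n) f) \<longlonglongrightarrow> 0"
proof -
  have "(\<lambda>n. (gram K (x n) (y n) - wsum (y n) f) - (gram K (y n) (x n) - wsum (x n) g)) \<longlonglongrightarrow> 0 - 0"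
    by (intro tendsto_diff represents_gram_tendsto[OF x y g] represents_gram_tendsto[OF y x f])
  then show ?thesis
    using gram_sym[OF cov represents_in[OF x] represents_in[OF y]] by simp
qed

lemma represents_pointwise:
  assumes "represents x f" "y \<in> V"
  shows "(\<lambda>n. gram K (x n) y) \<longlonglongrightarrow> wsum y f"
proof -
  have "(\<lambda>n. gram K (x n) y - wsum y f) \<longlonglongrightarrow> 0"
    using assms by (intro tendsto_zero_of_square_le[of _ "gram K y y"]) (auto simp: represents_def)
  then show ?thesis by (simp add: LIM_zero_iff)
qed

lemma represents_convergent:
  assumes x: "represents x f" and g: "g \<in> dominated"
  shows "convergent (\<lambda>n. wsum (x n) g)"
proof -
  obtain C where C: "0 \<le> C" "\<And>x. x \<in> V \<Longrightarrow> (wsum x g)\<^sup>2 \<le> C * gram K x x"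
    using g by (auto simp: dominated_def dominated_by_def)
  have "Cauchy (\<lambda>n. wsum (x n) g)"
  proof (rule metric_CauchyI)
    fix e :: real assume "0 < e"
    have pos: "0 < e\<^sup>2 / (4 * (C + 1))" using \<open>0 < e\<close> C(1) by simp
    obtain N where N: "inverse (real (Suc N)) < e\<^sup>2 / (4 * (C + 1))"
      using reals_Archimedean[OF pos] by blast
    have "dist (wsum (x m) g) (wsum (x n) g) < e" if "m \<ge> N" "n \<ge> N" for m n
    proof -
      let ?d = "x m @ wscale (-1) (x n)"
      have le: "inverse (real (Suc k)) \<le> inverse (real (Suc N))" if "k \<ge> N" for k
        using that by (simp add: field_simps)
      have d: "?d \<in> V" using represents_in[OF x] by blast
      have "(wsum ?d g)\<^sup>2 \<le> C * gram K ?d ?d" by (rule C(2)[OF d])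
      also have "\<dots> \<le> (C + 1) * gram K ?d ?d"
        using gram_nonneg[OF d] by (intro mult_right_mono) auto
      also have "\<dots> \<le> (C + 1) * (4 * inverse (real (Suc N)))"
        using represents_Cauchy[OF x, of m n] le[OF that(1)] le[OF that(2)] C(1)
        by (intro mult_left_mono) linarith+
      also have "\<dots> < (C + 1) * (4 * (e\<^sup>2 / (4 * (C + 1))))"
        using N C(1) by (intro mult_strict_left_mono) auto
      also have "\<dots> = e\<^sup>2" using C(1) by (simp add: divide_simps)
      finally have "\<bar>wsum ?d g\<bar> < e"
        using \<open>0 < e\<close> by (simp add: abs_square_less_1 power2_less_imp_less)
      then show ?thesis by (simp add: dist_real_def)
    qed
    then show "\<exists>N. \<forall>m\<ge>N. \<forall>n\<ge>N. dist (wsum (x m) g) (wsum (x n) g) < e" by blast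
  qed
  then show ?thesis by (simp add: Cauchy_convergent_iff)
qed

section \<open>Existence of the reproducing kernel Hilbert space\<close>

text \<open>
  The pairing of \<open>g\<close> with the would-be Riesz vector of \<open>f\<close>. Any representing sequence gives the same
  value, by \<open>kernel_inner_tendsto\<close>.
\<close>

definition kernel_inner :: "('a \<Rightarrow> real) \<Rightarrow> ('a \<Rightarrow> real) \<Rightarrow> real" where
  "kernel_inner f g = lim (\<lambda>n. wsum ((SOME x. represents x f) n) g)"

lemma kernel_inner_tendsto:
  assumes x: "represents x f" and f: "f \<in> dominated" and g: "g \<in> dominated"
  shows "(\<lambda>n. wsum (x n) g) \<longlonglongrightarrow> kernel_inner f g"
proof -
  define x' where "x' = (SOME x. represents x f)"
  have x': "represents x' f" unfolding x'_def using x by (rule someI[of "\<lambda>x. represents x f"])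
  obtain y where y: "represents y g" using represents_exists[OF g] by blast
  have "(\<lambda>n. (wsum (x n) g - wsum (y n) f) - (wsum (x' n) g - wsum (y n) f)) \<longlonglongrightarrow> 0 - 0"
    by (intro tendsto_diff represents_sym[OF x f y g] represents_sym[OF x' f y g])
  then have eq: "(\<lambda>n. wsum (x n) g - wsum (x' n) g) \<longlonglongrightarrow> 0" by simp
  have "(\<lambda>n. wsum (x' n) g) \<longlonglongrightarrow> kernel_inner f g"
    using represents_convergent[OF x' g] unfolding kernel_inner_def x'_def[symmetric]
    by (simp add: convergent_LIMSEQ_iff)
  then show ?thesis by (rule Lim_transform[OF _ eq])
qed

lemma kernel_inner_sym:
  assumes f: "f \<in> dominated" and g: "g \<in> dominated"
  shows "kernel_inner f g = kernel_inner g f"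
proof -
  obtain x y where x: "represents x f" and y: "represents y g"
    using represents_exists[OF f] represents_exists[OF g] by blast
  have "(\<lambda>n. wsum (x n) g - wsum (y n) f) \<longlonglongrightarrow> kernel_inner f g - kernel_inner g f"
    by (intro tendsto_diff kernel_inner_tendsto[OF x f g] kernel_inner_tendsto[OF y g f])
  from LIMSEQ_unique[OF represents_sym[OF x f y g] this] show ?thesis
    by simp
qed

lemma kernel_inner_add_right:
  assumes f: "f \<in> dominated" and g: "g \<in> dominated" and h: "h \<in> dominated"
  shows "kernel_inner f (\<lambda>t. g t + h t) = kernel_inner f g + kernel_inner f h"
proof -
  obtain x where x: "represents x f" using represents_exists[OF f] by blast
  have "(\<lambda>n. wsum (x n) (\<lambda>t. g t + h t)) \<longlonglongrightarrow> kernel_inner f g + kernel_inner f h"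
    unfolding wsum_add by (intro tendsto_add kernel_inner_tendsto[OF x f g] kernel_inner_tendsto[OF x f h])
  with kernel_inner_tendsto[OF x f dominated_add[OF g h]] show ?thesis
    by (rule LIMSEQ_unique)
qed

lemma kernel_inner_cmult_right:
  assumes f: "f \<in> dominated" and g: "g \<in> dominated"
  shows "kernel_inner f (\<lambda>t. c * g t) = c * kernel_inner f g"
proof -
  obtain x where x: "represents x f" using represents_exists[OF f] by blast
  have "(\<lambda>n. wsum (x n) (\<lambda>t. c * g t)) \<longlonglongrightarrow> c * kernel_inner f g"
    unfolding wsum_cmult by (intro tendsto_mult_left kernel_inner_tendsto[OF x f g])
  with kernel_inner_tendsto[OF x f dominated_cmult[OF g]] show ?thesis
    by (rule LIMSEQ_unique)
qed

lemma kernel_inner_wsum_right: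
  assumes f: "f \<in> dominated" and "x \<in> weighted_points T" "\<And>t. t \<in> T \<Longrightarrow> G t \<in> dominated"
  shows "kernel_inner f (\<lambda>u. wsum x (\<lambda>t. G t u)) = wsum x (\<lambda>t. kernel_inner f (G t))"
  using assms(2)
proof (induction x)
  case Nil
  then show ?case using kernel_inner_cmult_right[OF f dominated_zero, of 0] by simp
next
  case (Cons p x)
  obtain a t where p: "p = (a, t)" by (cases p)
  have t: "t \<in> T" and x: "x \<in> weighted_points T"
    using Cons.prems by (auto simp: p weighted_points_Cons)
  then show ?case
    using Cons.IH[OF x] f assms(3)
    by (simp add: p kernel_inner_add_right kernel_inner_cmult_right dominated_cmult dominated_wsum[OF x])
qed

lemma gram_tendsto_kernel_inner:
  assumes x: "represents x f" and f: "f \<in> dominated"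
  shows "(\<lambda>n. gram K (x n) (x n)) \<longlonglongrightarrow> kernel_inner f f"
  using tendsto_add[OF represents_gram_tendsto[OF x x f] kernel_inner_tendsto[OF x f f]] by simp

lemma kernel_inner_nonneg:
  assumes f: "f \<in> dominated"
  shows "0 \<le> kernel_inner f f"
proof -
  obtain x where x: "represents x f" using represents_exists[OF f] by blast
  show ?thesis
    by (rule tendsto_lowerbound[OF gram_tendsto_kernel_inner[OF x f]])
       (auto simp: gram_nonneg represents_in[OF x])
qed

text \<open>
  Together with \<open>kernel_inner_le_of_dominated_by\<close> this identifies the squared norm of \<open>f\<close> as the least
  constant that dominates \<open>f\<close>. The bound here is Cauchy--Schwarz for \<open>gram\<close>, in the limit along a
  representing sequence.
\<close>

lemma dominated_by_kernel_inner:
  assumes f: "f \<in> dominated"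
  shows "dominated_by (kernel_inner f f) f"
proof -
  obtain x where x: "represents x f" using represents_exists[OF f] by blast
  have "(wsum y f)\<^sup>2 \<le> kernel_inner f f * gram K y y" if y: "y \<in> V" for y
  proof (rule tendsto_le[OF _ _ tendsto_power[OF represents_pointwise[OF x y]]])
    show "(\<lambda>n. gram K (x n) (x n) * gram K y y) \<longlonglongrightarrow> kernel_inner f f * gram K y y"
      by (intro tendsto_mult_right gram_tendsto_kernel_inner[OF x f])
    show "\<forall>\<^sub>F n in sequentially. (gram K (x n) y)\<^sup>2 \<le> gram K (x n) (x n) * gram K y y"
      using gram_Cauchy_Schwarz[OF cov represents_in[OF x] y] by simp
  qed simp
  then show ?thesis using kernel_inner_nonneg[OF f] by (simp add: dominated_by_def)
qed

lemma kernel_inner_le_of_dominated_by: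
  assumes f: "f \<in> dominated" and C: "dominated_by C f"
  shows "kernel_inner f f \<le> C"
proof (rule le_of_square_le_mult)
  obtain x where x: "represents x f" using represents_exists[OF f] by blast
  show "(kernel_inner f f)\<^sup>2 \<le> C * kernel_inner f f"
  proof (rule tendsto_le[OF _ _ tendsto_power[OF kernel_inner_tendsto[OF x f f]]])
    show "(\<lambda>n. C * gram K (x n) (x n)) \<longlonglongrightarrow> C * kernel_inner f f"
      by (intro tendsto_mult_left gram_tendsto_kernel_inner[OF x f])
    show "\<forall>\<^sub>F n in sequentially. (wsum (x n) f)\<^sup>2 \<le> C * gram K (x n) (x n)"
      using C represents_in[OF x] by (simp add: dominated_by_def)
  qed simp
qed (use C in \<open>simp add: dominated_by_def\<close>)

lemma kernel_inner_eq_zero: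
  assumes f: "f \<in> dominated" and "kernel_inner f f = 0"
  shows "f = (\<lambda>_. 0)"
proof
  fix t
  show "f t = 0"
  proof (cases "t \<in> S")
    case True
    then have "(wsum [(1, t)] f)\<^sup>2 \<le> 0"
      using dominated_by_kernel_inner[OF f] assms(2) unfolding dominated_by_def
      by (metis mult_zero_left weighted_points_intros(2))
    then show ?thesis by simp
  qed (use f in \<open>simp add: dominated_def\<close>)
qed

abbreviation "kernel_section t \<equiv> restr0 S (\<lambda>u. K (t, u))"

lemma wsum_restr0 [simp]: "x \<in> V \<Longrightarrow> wsum x (restr0 S f) = wsum x f"
  by (erule wsum_cong) (simp add: restr0_def)

text \<open>
  The functional \<open>gram K x\<close> on families over \<open>S\<close> is the action of a combination of kernel sections.
  The points of \<open>x\<close> may lie outside \<open>S\<close>, which is what the gluing below uses.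
\<close>

lemma gram_eq_wsum_sections:
  assumes y: "y \<in> V"
  shows "gram K x y = wsum y (\<lambda>u. wsum x (\<lambda>s. kernel_section s u))"
proof -
  have "gram K x y = wsum y (\<lambda>u. wsum x (\<lambda>s. K (s, u)))"
    unfolding gram_def by (rule wsum_swap)
  also have "\<dots> = wsum y (\<lambda>u. wsum x (\<lambda>s. kernel_section s u))"
    by (rule wsum_cong[OF y]) (simp add: restr0_def)
  finally show ?thesis .
qed

text \<open>
  The base point \<open>t\<close> may lie outside \<open>S\<close>, as long as \<open>K\<close> is still a covariance on a set containing
  \<open>t\<close> and \<open>S\<close>: the bound is then Cauchy--Schwarz in the larger set.
\<close>

lemma kernel_section_dominated:
  assumes T: "covariance_on T K" "S \<subseteq> T" and t: "t \<in> T"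
  shows "kernel_section t \<in> dominated"
proof -
  have "dominated_by (K (t, t)) (kernel_section t)"
    unfolding dominated_by_def
  proof (intro conjI ballI)
    have "0 \<le> gram K [(1, t)] [(1, t)]"
      using T(1) weighted_points_intros(2)[OF t] unfolding covariance_on_iff_gram by blast
    then show "0 \<le> K (t, t)" by (simp add: gram_def)
    fix x assume x: "x \<in> V"
    have "(gram K [(1, t)] x)\<^sup>2 \<le> gram K [(1, t)] [(1, t)] * gram K x x"
      using t weighted_points_mono[OF x T(2)] by (intro gram_Cauchy_Schwarz[OF T(1)]) auto
    then show "(wsum x (kernel_section t))\<^sup>2 \<le> K (t, t) * gram K x x"
      using x by (simp add: gram_def)
  qed
  then show ?thesis by (auto simp: dominated_def restr0_def)
qed

text \<open>
  The reproducing property: pairing a representing sequence with the section at \<open>t\<close> is evaluating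
  its \<open>gram\<close> at the unit mass at \<open>t\<close>.
\<close>

lemma kernel_inner_section:
  assumes f: "f \<in> dominated" and t: "t \<in> S"
  shows "kernel_inner f (kernel_section t) = f t"
proof -
  obtain x where x: "represents x f" using represents_exists[OF f] by blast
  have "(\<lambda>n. gram K (x n) [(1, t)]) \<longlonglongrightarrow> f t"
    using represents_pointwise[OF x, of "[(1, t)]"] t by simp
  moreover have eq: "gram K (x n) [(1, t)] = wsum (x n) (kernel_section t)" for n
    using gram_sym[OF cov represents_in[OF x], of "[(1, t)]" n] t represents_in[OF x, of n]
    by (simp add: gram_def)
  ultimately show ?thesis
    using LIMSEQ_unique[OF kernel_inner_tendsto[OF x f kernel_section_dominated[OF cov order_refl t]]]
    by (simp add: eq)
qed

text \<open>
  A Cauchy sequence converges at every point of \<open>S\<close>, because evaluation is bounded. The uniform bound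
  for \<open>F m - F n\<close> passes to \<open>n \<longlonglongrightarrow> \<infinity>\<close> family by family, so \<open>F m - f\<close> is dominated with a small
  constant; this gives both membership of \<open>f\<close> and convergence in norm.
\<close>

lemma dominated_complete:
  fixes F :: "nat \<Rightarrow> 'a \<Rightarrow> real"
  defines "d \<equiv> \<lambda>f g. sqrt (kernel_inner (\<lambda>x. f x - g x) (\<lambda>x. f x - g x))"
  assumes F: "range F \<subseteq> dominated" and Cau: "\<forall>e>0. \<exists>N. \<forall>m\<ge>N. \<forall>n\<ge>N. d (F m) (F n) < e"
  shows "\<exists>f\<in>dominated. (\<lambda>n. d (F n) f) \<longlonglongrightarrow> 0"
proof -
  have Fd: "F n \<in> dominated" for n using F by blast
  have wsum_le: "(wsum x (F m) - wsum x (F n))\<^sup>2 \<le> (d (F m) (F n))\<^sup>2 * gram K x x"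
    if "x \<in> V" for x m n
    using dominated_by_kernel_inner[OF dominated_diff[OF Fd Fd, of m n]]
      kernel_inner_nonneg[OF dominated_diff[OF Fd Fd, of m n]] that
    by (simp add: d_def dominated_by_def wsum_diff)
  have conv: "convergent (\<lambda>n. F n t)" for t
  proof (cases "t \<in> S")
    case True
    let ?k = "gram K [(1, t)] [(1, t)]"
    have k: "0 \<le> ?k" using True by (intro gram_nonneg) auto
    have "Cauchy (\<lambda>n. F n t)"
    proof (rule metric_CauchyI)
      fix e :: real assume e: "0 < e"
      obtain N where N: "\<forall>m\<ge>N. \<forall>n\<ge>N. d (F m) (F n) < e / (sqrt ?k + 1)"
        using Cau e k by (metis divide_pos_pos add_nonneg_pos real_sqrt_ge_zero zero_less_one)
      have "dist (F m t) (F n t) < e" if "m \<ge> N" "n \<ge> N" for m n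
      proof -
        have "\<bar>F m t - F n t\<bar> \<le> d (F m) (F n) * sqrt ?k"
          using real_sqrt_le_mono[OF wsum_le[of "[(1, t)]" m n]] True
            kernel_inner_nonneg[OF dominated_diff[OF Fd Fd, of m n]]
          by (simp add: real_sqrt_mult d_def)
        also have "\<dots> \<le> e / (sqrt ?k + 1) * sqrt ?k"
          using N that k by (intro mult_right_mono) (auto intro: less_imp_le)
        also have "\<dots> < e" using e k
          by (simp add: pos_divide_less_eq add_nonneg_pos)
        finally show ?thesis by (simp add: dist_real_def)
      qed
      then show "\<exists>N. \<forall>m\<ge>N. \<forall>n\<ge>N. dist (F m t) (F n t) < e" by blast
    qed
    then show ?thesis by (simp add: Cauchy_convergent_iff)
  next
    case False
    then have "F n t = 0" for n using Fd by (simp add: dominated_def)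
    then show ?thesis by (simp add: convergent_const)
  qed
  define f where "f t = lim (\<lambda>n. F n t)" for t
  have f: "(\<lambda>n. F n t) \<longlonglongrightarrow> f t" for t
    using conv by (simp add: f_def convergent_LIMSEQ_iff)
  have f0: "f t = 0" if "t \<notin> S" for t
  proof -
    have "F n t = 0" for n using Fd that by (simp add: dominated_def)
    then show ?thesis using f[of t] by (simp add: LIMSEQ_const_iff)
  qed
  have close: "\<exists>N. \<forall>m\<ge>N. dominated_by (e\<^sup>2) (\<lambda>t. F m t - f t)" if e: "0 < e" for e :: real
  proof -
    obtain N where N: "\<forall>m\<ge>N. \<forall>n\<ge>N. d (F m) (F n) < e" using Cau e by blast
    have "dominated_by (e\<^sup>2) (\<lambda>t. F m t - f t)" if "m \<ge> N" for m
      unfolding dominated_by_def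
    proof (intro conjI ballI)
      fix x assume x: "x \<in> V"
      have lim: "(\<lambda>n. (wsum x (F m) - wsum x (F n))\<^sup>2) \<longlonglongrightarrow> (wsum x (F m) - wsum x f)\<^sup>2"
        by (intro tendsto_power tendsto_diff tendsto_const wsum_tendsto[OF x f])
      have le: "(wsum x (F m) - wsum x (F n))\<^sup>2 \<le> e\<^sup>2 * gram K x x" if "n \<ge> N" for n
      proof -
        have "d (F m) (F n) \<le> e" "0 \<le> d (F m) (F n)"
          using N \<open>m \<ge> N\<close> that kernel_inner_nonneg[OF dominated_diff[OF Fd Fd, of m n]]
          by (blast intro: less_imp_le, simp add: d_def)
        then show ?thesis
          by (intro order_trans[OF wsum_le[OF x] mult_right_mono[OF power_mono gram_nonneg[OF x]]])
      qed
      show "(wsum x (\<lambda>t. F m t - f t))\<^sup>2 \<le> e\<^sup>2 * gram K x x"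
        unfolding wsum_diff by (rule LIMSEQ_le_const2[OF lim]) (use le in blast)
    qed simp
    then show ?thesis by blast
  qed
  have dom: "(\<lambda>t. F m t - f t) \<in> dominated" if "dominated_by C (\<lambda>t. F m t - f t)" for C m
    using that f0 Fd[of m] by (auto simp: dominated_def)
  obtain N where "dominated_by (1\<^sup>2) (\<lambda>t. F N t - f t)" using close[of 1] by auto
  from dominated_diff[OF Fd[of N] dom[OF this]] have fd: "f \<in> dominated" by simp
  have "(\<lambda>n. d (F n) f) \<longlonglongrightarrow> 0"
  proof (rule LIMSEQ_I)
    fix r :: real assume r: "0 < r"
    obtain N where N: "\<forall>m\<ge>N. dominated_by ((r / 2)\<^sup>2) (\<lambda>t. F m t - f t)"
      using close[of "r / 2"] r by auto
    have "norm (d (F n) f - 0) < r" if "n \<ge> N" for n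
    proof -
      have "d (F n) f \<le> sqrt ((r / 2)\<^sup>2)"
        unfolding d_def using N that dom by (intro real_sqrt_le_mono kernel_inner_le_of_dominated_by) blast+
      moreover have "0 \<le> d (F n) f"
        unfolding d_def using kernel_inner_nonneg[OF dominated_diff[OF Fd fd]] by simp
      ultimately show ?thesis using r by simp
    qed
    then show "\<exists>N. \<forall>n\<ge>N. norm (d (F n) f - 0) < r" by blast
  qed
  with fd show ?thesis by blast
qed

theorem is_rkhs_dominated: "is_rkhs S K dominated kernel_inner"
  unfolding is_rkhs_def hilbert_function_space_def Let_def
proof (intro conjI ballI allI impI)
  fix f g h c assume f: "f \<in> dominated" and g: "g \<in> dominated" and h: "h \<in> dominated"
  show "kernel_inner (\<lambda>x. f x + g x) h = kernel_inner f h + kernel_inner g h"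
    using f g h by (simp add: kernel_inner_sym[of _ h] kernel_inner_add_right dominated_add)
next
  fix f g c assume f: "f \<in> dominated" and g: "g \<in> dominated"
  show "kernel_inner (\<lambda>x. c * f x) g = c * kernel_inner f g"
    using f g by (simp add: kernel_inner_sym[of _ g] kernel_inner_cmult_right dominated_cmult)
next
  fix F :: "nat \<Rightarrow> 'a \<Rightarrow> real"
  assume "range F \<subseteq> dominated \<and> (\<forall>e>0. \<exists>N. \<forall>m\<ge>N. \<forall>n\<ge>N.
    sqrt (kernel_inner (\<lambda>x. F m x - F n x) (\<lambda>x. F m x - F n x)) < e)"
  then show "\<exists>f\<in>dominated. (\<lambda>n. sqrt (kernel_inner (\<lambda>x. F n x - f x) (\<lambda>x. F n x - f x))) \<longlonglongrightarrow> 0"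
    using dominated_complete[of F] by blast
qed (auto simp: dominated_zero dominated_add dominated_cmult kernel_inner_sym kernel_inner_nonneg kernel_inner_eq_zero
      kernel_inner_section kernel_section_dominated[OF cov order_refl], auto simp: dominated_def)

section \<open>Uniqueness of the reproducing kernel Hilbert space\<close>

text \<open>
  Let \<open>comb x\<close> be the combination of kernel sections given by the family \<open>x\<close>. The reproducing property
  makes \<open>comb\<close> an isometry from \<open>gram\<close> into any competing space \<open>H\<close>, with \<open>ip (comb x) f = wsum x f\<close>;
  Cauchy--Schwarz in \<open>H\<close> then shows that members of \<open>H\<close> are dominated. Conversely, if \<open>x n\<close> represents
  a dominated \<open>f\<close>, then \<open>comb (x n)\<close> is Cauchy in \<open>H\<close>. Its limit agrees with \<open>f\<close> at every point, so
  \<open>f\<close> lies in \<open>H\<close>, and inner products with \<open>f\<close> are the limits that define \<open>kernel_inner\<close>.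
\<close>

lemma is_rkhs_unique:
  assumes R: "is_rkhs S K H ip"
  shows "H = dominated" and "\<And>f g. f \<in> H \<Longrightarrow> g \<in> H \<Longrightarrow> ip f g = kernel_inner f g"
proof -
  from R have van': "\<forall>f\<in>H. \<forall>x. x \<notin> S \<longrightarrow> f x = 0"
    and zero: "(\<lambda>_. 0) \<in> H"
    and add': "\<forall>f\<in>H. \<forall>g\<in>H. (\<lambda>x. f x + g x) \<in> H"
    and cmult': "\<forall>c. \<forall>f\<in>H. (\<lambda>x. c * f x) \<in> H"
    and sym': "\<forall>f\<in>H. \<forall>g\<in>H. ip f g = ip g f"
    and ip_add': "\<forall>f\<in>H. \<forall>g\<in>H. \<forall>h\<in>H. ip (\<lambda>x. f x + g x) h = ip f h + ip g h"
    and ip_cmult': "\<forall>c. \<forall>f\<in>H. \<forall>g\<in>H. ip (\<lambda>x. c * f x) g = c * ip f g"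
    and nonneg': "\<forall>f\<in>H. ip f f \<ge> 0 \<and> (ip f f = 0 \<longrightarrow> f = (\<lambda>_. 0))"
    and complete': "\<forall>F. range F \<subseteq> H \<and>
        (\<forall>e>0. \<exists>N. \<forall>m\<ge>N. \<forall>n\<ge>N. sqrt (ip (\<lambda>x. F m x - F n x) (\<lambda>x. F m x - F n x)) < e) \<longrightarrow>
        (\<exists>f\<in>H. (\<lambda>n. sqrt (ip (\<lambda>x. F n x - f x) (\<lambda>x. F n x - f x))) \<longlonglongrightarrow> 0)"
    and repr': "\<forall>t\<in>S. kernel_section t \<in> H \<and> (\<forall>f\<in>H. ip f (kernel_section t) = f t)"
    unfolding is_rkhs_def hilbert_function_space_def Let_def
    by - ((elim conjE, assumption)+)
  note van = van'[rule_format] and add = add'[rule_format] and cmult = cmult'[rule_format]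
    and sym = sym'[rule_format] and ip_add = ip_add'[rule_format]
    and ip_cmult = ip_cmult'[rule_format] and nonneg = nonneg'[rule_format, THEN conjunct1]
    and complete = complete'[rule_format, OF conjI]
    and sec = repr'[rule_format, THEN conjunct1]
    and repr = repr'[rule_format, THEN conjunct2, rule_format]
  have diff: "(\<lambda>x. f x - g x) \<in> H" if "f \<in> H" "g \<in> H" for f g
    using add[OF that(1) cmult[OF that(2), of "-1"]] by simp
  have ip_diff: "ip (\<lambda>x. f x - g x) h = ip f h - ip g h" if "f \<in> H" "g \<in> H" "h \<in> H" for f g h
    using ip_add[OF that(1) cmult[OF that(2), of "-1"] that(3)]
      ip_cmult[OF that(2) that(3), of "-1"] by simp
  have CS: "(ip f g)\<^sup>2 \<le> ip f f * ip g g" if f: "f \<in> H" and g: "g \<in> H" for f g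
  proof (rule nonneg_quadratic_discriminant)
    fix c
    have cg: "(\<lambda>x. c * g x) \<in> H" by (rule cmult[OF g])
    have s: "(\<lambda>x. f x + c * g x) \<in> H" by (rule add[OF f cg])
    have 1: "ip (\<lambda>x. f x + c * g x) k = ip f k + c * ip g k" if "k \<in> H" for k
      using ip_add[OF f cg that] ip_cmult[OF g that, of c] by simp
    have "0 \<le> ip (\<lambda>x. f x + c * g x) (\<lambda>x. f x + c * g x)" by (rule nonneg[OF s])
    also have "\<dots> = ip f f + 2 * c * ip f g + c\<^sup>2 * ip g g"
      using 1[OF s] sym[OF f s] sym[OF g s] 1[OF f] 1[OF g] sym[OF f g]
      by (simp add: algebra_simps power2_eq_square)
    finally show "0 \<le> ip f f + 2 * c * ip f g + c\<^sup>2 * ip g g" .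
  qed (rule nonneg[OF g])
  define comb where "comb x = (\<lambda>u. wsum x (\<lambda>t. kernel_section t u))" for x
  have comb: "comb x \<in> H \<and> (\<forall>f\<in>H. ip (comb x) f = wsum x f)" if "x \<in> V" for x
    using that
  proof (induction x)
    case Nil
    show ?case using zero ip_cmult[OF zero, of _ 0] by (simp add: comb_def)
  next
    case (Cons p x)
    obtain a t where p: "p = (a, t)" by (cases p)
    have t: "t \<in> S" and x: "x \<in> V" using Cons.prems by (auto simp: p weighted_points_Cons)
    have eq: "comb (p # x) = (\<lambda>u. a * kernel_section t u + comb x u)" by (simp add: comb_def p)
    have c: "comb x \<in> H" using Cons.IH[OF x] by blast
    have "ip (comb (p # x)) f = wsum (p # x) f" if f: "f \<in> H" for f
      unfolding eq using ip_add[OF cmult[OF sec[OF t]] c f, of a] ip_cmult[OF sec[OF t] f, of a]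
        repr[OF t f] sym[OF sec[OF t] f] Cons.IH[OF x] f by (simp add: p)
    moreover have "comb (p # x) \<in> H" unfolding eq by (intro add cmult sec t c)
    ultimately show ?case by blast
  qed
  have combH: "comb x \<in> H" and ip_comb: "\<And>f. f \<in> H \<Longrightarrow> ip (comb x) f = wsum x f"
    if "x \<in> V" for x using comb[OF that] by blast+
  have comb_eq: "comb x t = gram K x [(1, t)]" if "t \<in> S" for x t
    using that by (simp add: comb_def gram_def restr0_def)
  have ip_comb_comb: "ip (comb x) (comb x) = gram K x x" if x: "x \<in> V" for x
  proof -
    have "ip (comb x) (comb x) = wsum x (comb x)" by (rule ip_comb[OF x combH[OF x]])
    also have "\<dots> = gram K x x" unfolding comb_def by (rule gram_eq_wsum_sections[OF x, symmetric])
    finally show ?thesis .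
  qed
  have sub: "f \<in> dominated" if f: "f \<in> H" for f
  proof -
    have "dominated_by (ip f f) f"
      unfolding dominated_by_def
    proof (intro conjI ballI)
      fix x assume x: "x \<in> V"
      show "(wsum x f)\<^sup>2 \<le> ip f f * gram K x x"
        using CS[OF combH[OF x] f] ip_comb[OF x f] ip_comb_comb[OF x] by (simp add: mult.commute)
    qed (rule nonneg[OF f])
    then show ?thesis using van[OF f] by (auto simp: dominated_def)
  qed
  have main: "f \<in> H \<and> (\<forall>g\<in>H. ip f g = kernel_inner f g)" if f: "f \<in> dominated" for f
  proof -
    obtain x where x: "represents x f" using represents_exists[OF f] by blast
    note xV = represents_in[OF x]
    have comb_diff: "(\<lambda>u. comb (x m) u - comb (x n) u) = comb (x m @ wscale (-1) (x n))" for m n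
      by (simp add: comb_def)
    have "\<exists>N. \<forall>m\<ge>N. \<forall>n\<ge>N.
        sqrt (ip (\<lambda>u. comb (x m) u - comb (x n) u) (\<lambda>u. comb (x m) u - comb (x n) u)) < e"
      if e: "0 < e" for e
    proof -
      have "0 < e\<^sup>2 / 4" using e by simp
      from reals_Archimedean[OF this] obtain N where N: "inverse (real (Suc N)) < e\<^sup>2 / 4" by blast
      have "sqrt (ip (comb (x m @ wscale (-1) (x n))) (comb (x m @ wscale (-1) (x n)))) < e"
        if "m \<ge> N" "n \<ge> N" for m n
      proof -
        have le: "inverse (real (Suc k)) \<le> inverse (real (Suc N))" if "k \<ge> N" for k
          using that by (simp add: field_simps)
        have d: "x m @ wscale (-1) (x n) \<in> V" using xV by blast
        have "ip (comb (x m @ wscale (-1) (x n))) (comb (x m @ wscale (-1) (x n))) < e\<^sup>2"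
          unfolding ip_comb_comb[OF d]
          using represents_Cauchy[OF x, of m n] le[OF that(1)] le[OF that(2)] N by linarith
        then show ?thesis using e by (intro real_less_lsqrt) auto
      qed
      then show ?thesis unfolding comb_diff by blast
    qed
    moreover have "range (\<lambda>n. comb (x n)) \<subseteq> H" using combH[OF xV] by blast
    ultimately obtain h where h: "h \<in> H"
      and lim: "(\<lambda>n. sqrt (ip (\<lambda>u. comb (x n) u - h u) (\<lambda>u. comb (x n) u - h u))) \<longlonglongrightarrow> 0"
      using complete[of "\<lambda>n. comb (x n)"] by blast
    have weak: "(\<lambda>n. ip (comb (x n)) g) \<longlonglongrightarrow> ip h g" if g: "g \<in> H" for g
    proof -
      have "(\<lambda>n. ip (comb (x n)) g - ip h g) \<longlonglongrightarrow> 0"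
      proof (rule Lim_null_comparison)
        show "(\<lambda>n. sqrt (ip (\<lambda>u. comb (x n) u - h u) (\<lambda>u. comb (x n) u - h u)) * sqrt (ip g g)) \<longlonglongrightarrow> 0"
          using tendsto_mult_right[OF lim, of "sqrt (ip g g)"] by simp
        have "\<bar>ip (comb (x n)) g - ip h g\<bar>
            \<le> sqrt (ip (\<lambda>u. comb (x n) u - h u) (\<lambda>u. comb (x n) u - h u)) * sqrt (ip g g)" for n
          using real_sqrt_le_mono[OF CS[OF diff[OF combH[OF xV, of n] h] g]]
            ip_diff[OF combH[OF xV] h g, of n]
          by (simp add: real_sqrt_mult)
        then show "\<forall>\<^sub>F n in sequentially. norm (ip (comb (x n)) g - ip h g)
            \<le> sqrt (ip (\<lambda>u. comb (x n) u - h u) (\<lambda>u. comb (x n) u - h u)) * sqrt (ip g g)"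
          by simp
      qed
      then show ?thesis by (simp add: LIM_zero_iff)
    qed
    have "h = f"
    proof
      fix t
      show "h t = f t"
      proof (cases "t \<in> S")
        case True
        have "(\<lambda>n. comb (x n) t) \<longlonglongrightarrow> h t"
          using weak[OF sec[OF True]] repr[OF True h] repr[OF True combH[OF xV]] by simp
        moreover have "(\<lambda>n. comb (x n) t) \<longlonglongrightarrow> f t"
          using represents_pointwise[OF x, of "[(1, t)]"] True by (simp add: comb_eq)
        ultimately show ?thesis by (rule LIMSEQ_unique)
      next
        case False
        then show ?thesis using f van[OF h] by (simp add: dominated_def)
      qed
    qed
    moreover have "ip h g = kernel_inner f g" if g: "g \<in> H" for g
      using LIMSEQ_unique[OF _ kernel_inner_tendsto[OF x f sub[OF g]]] weak[OF g] ip_comb[OF xV g] by simp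
    ultimately show ?thesis using h by blast
  qed
  show "H = dominated" using sub main by blast
  show "ip f g = kernel_inner f g" if "f \<in> H" "g \<in> H" for f g
    using main[OF sub[OF that(1)]] that(2) by blast
qed

lemma rkhs_eq_dominated: "rkhs S K = dominated"
  unfolding rkhs_def using is_rkhs_dominated is_rkhs_unique(1) by (intro the_equality) blast+

lemma rkhs_inner_eq_kernel_inner:
  assumes "f \<in> dominated" "g \<in> dominated"
  shows "rkhs_inner S K f g = kernel_inner f g"
  unfolding rkhs_inner_def
proof (rule the_equality)
  show "\<exists>H ip. is_rkhs S K H ip \<and> f \<in> H \<and> g \<in> H \<and> kernel_inner f g = ip f g"
    using assms is_rkhs_dominated by blast
qed (auto simp: is_rkhs_unique(2))

end

section \<open>Gluing two covariances along their common domain\<close>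

locale overlapping_covariances =
  fixes A B :: "'a set" and K :: "'a \<times> 'a \<Rightarrow> real"
  assumes covA: "covariance_on A K" and covB: "covariance_on B K"
begin

sublocale covariance_kernel "A \<inter> B" K
  by unfold_locales (rule covariance_on_subset[OF covA Int_lower1])

lemma kernel_section_in_dominated: "t \<in> A \<union> B \<Longrightarrow> kernel_section t \<in> dominated"
  using kernel_section_dominated[OF covA] kernel_section_dominated[OF covB] by blast

lemma column_eq_section:
  assumes "t \<in> A \<union> B"
  shows "restr0 (A \<inter> B) (\<lambda>u. K (u, t)) = kernel_section t"
  using assms covA covB by (auto simp: restr0_def covariance_on_def fun_eq_iff)

lemma K_star_on_domain: "p \<in> A \<times> A \<union> B \<times> B \<Longrightarrow> K_star A B K p = K p"
  by (auto simp: K_star_def)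

lemma K_star_off_domain:
  assumes "s \<in> A \<union> B" "t \<in> A \<union> B" "(s, t) \<notin> A \<times> A \<union> B \<times> B"
  shows "K_star A B K (s, t) = kernel_inner (kernel_section s) (kernel_section t)"
  using assms column_eq_section[OF assms(2)]
    rkhs_inner_eq_kernel_inner[OF kernel_section_in_dominated kernel_section_in_dominated, of s t]
  by (auto simp: K_star_def)

text \<open>
  The inner product formula also holds on the part of \<open>(A - B) \<times> B\<close> where \<open>K\<close> is already given,
  because for \<open>t\<close> in the overlap the reproducing property evaluates it to \<open>K (s, t)\<close>. So one formula
  covers all pairs with \<open>s \<in> A - B\<close> and \<open>t \<in> B\<close>.
\<close>

lemma K_star_across:
  assumes s: "s \<in> A - B" and t: "t \<in> B"
  shows "K_star A B K (s, t) = kernel_inner (kernel_section s) (kernel_section t)"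
proof (cases "t \<in> A")
  case True
  then have "kernel_inner (kernel_section s) (kernel_section t) = K (s, t)"
    using kernel_inner_section[OF kernel_section_in_dominated[of s], of t] s t by (simp add: restr0_def)
  then show ?thesis using K_star_on_domain[of "(s, t)"] s True by simp
next
  case False
  then show ?thesis using K_star_off_domain[of s t] s t by auto
qed

lemma K_star_sym:
  assumes s: "s \<in> A \<union> B" and t: "t \<in> A \<union> B"
  shows "K_star A B K (s, t) = K_star A B K (t, s)"
proof (cases "(s, t) \<in> A \<times> A \<union> B \<times> B")
  case True
  then show ?thesis
    using K_star_on_domain[of "(s, t)"] K_star_on_domain[of "(t, s)"] covA covB
    by (auto simp: covariance_on_def)
next
  case False
  then show ?thesis
    using K_star_off_domain[OF s t] K_star_off_domain[OF t s]
      kernel_inner_sym[OF kernel_section_in_dominated[OF s] kernel_section_in_dominated[OF t]] by auto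
qed

text \<open>
  Subtracting and adding the squared norm of \<open>g\<close>, the projection of the part outside \<open>B\<close> onto the
  overlap, writes the quadratic form as a sum of a limit of squared lengths in \<open>A\<close> and a limit of
  squared lengths in \<open>B\<close>.
\<close>

lemma gram_K_star_nonneg:
  assumes x: "x \<in> weighted_points (A \<union> B)"
  shows "0 \<le> gram (K_star A B K) x x"
proof -
  let ?Q = "gram (K_star A B K)"
  define a where "a = filter (\<lambda>p. snd p \<notin> B) x"
  define b where "b = filter (\<lambda>p. \<not> snd p \<notin> B) x"
  have a: "a \<in> weighted_points (A - B)" and b: "b \<in> weighted_points B"
    using x by (auto simp: a_def b_def weighted_points_def)
  have aA: "a \<in> weighted_points A" using a weighted_points_mono by blast
  have aU: "a \<in> weighted_points (A \<union> B)" and bU: "b \<in> weighted_points (A \<union> B)"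
    using aA b weighted_points_mono by blast+
  define g where "g = (\<lambda>u. wsum a (\<lambda>s. kernel_section s u))"
  define h where "h = (\<lambda>u. wsum b (\<lambda>t. kernel_section t u))"
  have g: "g \<in> dominated" and h: "h \<in> dominated"
    unfolding g_def h_def by (rule dominated_wsum[OF aU kernel_section_in_dominated]
        dominated_wsum[OF bU kernel_section_in_dominated], simp)+
  have aa: "?Q a a = gram K a a" and bb: "?Q b b = gram K b b"
    unfolding gram_def using K_star_on_domain
    by (auto intro!: wsum_cong[OF aA] wsum_cong[OF b])
  have ab: "?Q a b = kernel_inner g h"
  proof -
    have "?Q a b = wsum a (\<lambda>s. wsum b (\<lambda>t. kernel_inner (kernel_section s) (kernel_section t)))"
      unfolding gram_def using K_star_across by (auto intro!: wsum_cong[OF a] wsum_cong[OF b])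
    also have "\<dots> = wsum a (\<lambda>s. kernel_inner h (kernel_section s))"
      unfolding h_def
      using kernel_inner_wsum_right[OF kernel_section_in_dominated bU kernel_section_in_dominated]
        kernel_inner_sym[OF h kernel_section_in_dominated, unfolded h_def]
      by (auto intro!: wsum_cong[OF aU])
    also have "\<dots> = kernel_inner g h"
      unfolding g_def kernel_inner_sym[OF g h, unfolded g_def]
      using kernel_inner_wsum_right[OF h aU kernel_section_in_dominated] by simp
    finally show ?thesis .
  qed
  have ba: "?Q b a = ?Q a b"
  proof -
    have "?Q b a = wsum b (\<lambda>s. wsum a (\<lambda>t. K_star A B K (t, s)))"
      unfolding gram_def using K_star_sym by (auto intro!: wsum_cong[OF aU] wsum_cong[OF bU])
    also have "\<dots> = ?Q a b"
      unfolding gram_def by (rule wsum_swap)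
    finally show ?thesis .
  qed
  have split: "?Q x x = gram K a a + 2 * kernel_inner g h + gram K b b"
  proof -
    have w: "wsum x f = wsum a f + wsum b f" for f
      unfolding a_def b_def by (rule wsum_filter)
    have "?Q x x = ?Q a a + ?Q a b + ?Q b a + ?Q b b"
      by (simp add: gram_def w wsum_add)
    then show ?thesis using aa bb ab ba by simp
  qed
  obtain z where z: "represents z g" using represents_exists[OF g] by blast
  note zV = represents_in[OF z]
  have zA: "z n \<in> weighted_points A" and zB: "z n \<in> weighted_points B" for n
    using weighted_points_mono[OF zV] by blast+
  have za: "gram K a (z n) = wsum (z n) g" for n
    unfolding g_def by (rule gram_eq_wsum_sections[OF zV])
  have zb: "gram K b (z n) = wsum (z n) h" for n
    unfolding h_def by (rule gram_eq_wsum_sections[OF zV])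
  have lim_gg: "(\<lambda>n. gram K (z n) (z n)) \<longlonglongrightarrow> kernel_inner g g"
    by (rule gram_tendsto_kernel_inner[OF z g])
  \<comment> \<open>The residual variance of \<open>a\<close> given the overlap; all points involved lie in \<open>A\<close>.\<close>
  have "0 \<le> gram K a a - 2 * kernel_inner g g + kernel_inner g g"
  proof (rule tendsto_lowerbound)
    show "(\<lambda>n. gram K a a - 2 * wsum (z n) g + gram K (z n) (z n))
        \<longlonglongrightarrow> gram K a a - 2 * kernel_inner g g + kernel_inner g g"
      by (intro tendsto_intros lim_gg kernel_inner_tendsto[OF z g g])
    have "0 \<le> gram K (a @ wscale (-1) (z n)) (a @ wscale (-1) (z n))" for n
      using covA aA zA unfolding covariance_on_iff_gram by blast
    then show "\<forall>\<^sub>F n in sequentially. 0 \<le> gram K a a - 2 * wsum (z n) g + gram K (z n) (z n)"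
      using gram_sym[OF covA aA zA] za by (simp add: algebra_simps)
  qed simp
  \<comment> \<open>With the projection \<open>z n\<close> in place of \<open>a\<close>, all points involved lie in \<open>B\<close>.\<close>
  moreover have "0 \<le> kernel_inner g g + 2 * kernel_inner g h + gram K b b"
  proof (rule tendsto_lowerbound)
    show "(\<lambda>n. gram K (z n) (z n) + 2 * wsum (z n) h + gram K b b)
        \<longlonglongrightarrow> kernel_inner g g + 2 * kernel_inner g h + gram K b b"
      by (intro tendsto_intros lim_gg kernel_inner_tendsto[OF z g h])
    have "0 \<le> gram K (z n @ b) (z n @ b)" for n
      using covB b zB unfolding covariance_on_iff_gram by blast
    then show "\<forall>\<^sub>F n in sequentially. 0 \<le> gram K (z n) (z n) + 2 * wsum (z n) h + gram K b b"
      using gram_sym[OF covB b zB] zb by (simp add: algebra_simps)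
  qed simp
  ultimately show ?thesis unfolding split by linarith
qed

theorem covariance_on_K_star: "covariance_on (A \<union> B) (K_star A B K)"
  unfolding covariance_on_iff_gram using K_star_sym gram_K_star_nonneg by blast

end

theorem theorem3p2:
  fixes I I1 I2 :: "real set"
    and \<Omega> :: "(real \<times> real) set"
    and K :: "real \<times> real \<Rightarrow> real"
  assumes "is_interval I" and "is_interval I1" and "is_interval I2"
    and "I1 \<union> I2 = I"
    and "\<Omega> = I1 \<times> I1 \<union> I2 \<times> I2"
    and "partial_covariance I \<Omega> K"
  shows "(\<forall>s t. (s, t) \<in> I \<times> I - \<Omega> \<longrightarrow>
            restr0 (I1 \<inter> I2) (\<lambda>u. K (s, u)) \<in> rkhs (I1 \<inter> I2) K \<and>
            restr0 (I1 \<inter> I2) (\<lambda>u. K (u, t)) \<in> rkhs (I1 \<inter> I2) K) \<and>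
         covariance_on I (K_star I1 I2 K) \<and>
         K_star I1 I2 K \<in> completions I \<Omega> K \<and>
         (\<forall>C. completions I \<Omega> K = {C} \<longrightarrow> C = K_star I1 I2 K)"
proof -
  interpret overlapping_covariances I1 I2 K
    using assms(4-6) by unfold_locales (auto simp: partial_covariance_def)
  have cov_star: "covariance_on I (K_star I1 I2 K)"
    using covariance_on_K_star assms(4) by simp
  have ext: "K_star I1 I2 K \<in> extensional (I \<times> I)"
    unfolding K_star_def assms(4) by (rule restrict_extensional)
  have completion: "K_star I1 I2 K \<in> completions I \<Omega> K"
    using cov_star ext K_star_on_domain assms(5) by (simp add: completions_def)
  have "restr0 (I1 \<inter> I2) (\<lambda>u. K (s, u)) \<in> rkhs (I1 \<inter> I2) K \<and>
      restr0 (I1 \<inter> I2) (\<lambda>u. K (u, t)) \<in> rkhs (I1 \<inter> I2) K" if "s \<in> I" "t \<in> I" for s t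
    using that assms(4) kernel_section_in_dominated column_eq_section rkhs_eq_dominated by auto
  with cov_star completion show ?thesis by auto
qed

end
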